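(* If a sequent $\sigma$ is valid over the class of S5 frames, then $\sigma$ has a cyclic proof in $\mathrm{cICKS5}$ in which every occurring sequent $\Gamma\Rightarrow\Delta$ satisfies $\Gamma^-\cup\Delta^-\subseteq\mathrm{Cl}^\neg(\sigma)$ (in particular all cut formulae lie in $\mathrm{Cl}^\neg(\sigma)$).
   Context: Formulae over a finite non-empty set $\mathsf{A}$ of agents and atoms $\mathrm{Prop}$: $\varphi ::= \bot \mid p \mid \varphi\wedge\varphi\mid\varphi\vee\varphi\mid\varphi\to\varphi\mid K_a\varphi\mid C\varphi$; $\neg\varphi:=\varphi\to\bot$. A set of formulae is negation closed if: $\psi_1\ast\psi_2$ in it ($\ast\in\{\wedge,\vee,\to\}$) implies $\psi_1,\psi_2$ in it; $K_a\psi$ in it implies $\psi$ and $\neg K_a\psi$ in it; $C\psi$ in it implies $\psi$ and $K_aC\psi$ (all $a$) in it. $\mathrm{Cl}^\neg(\sigma)$ is the smallest negation closed set containing all formulae occurring (unannotated) in $\sigma$. S5 semantics: frames $(\mathcal{W},\leq,\{R_a\})$, $\mathcal{W}\neq\emptyset$, $\leq$ a partial order, each $R_a$ an equivalence relation, triangle confluence ($w\leq v$, $vR_au$ imply $wR_au$); models add a $\leq$-monotone valuation; $w\models\varphi\to\psi$ iff for all $v\geq w$, $v\models\varphi$ implies $v\models\psi$; $w\models K_a\varphi$ iff all $R_a$-successors satisfy $\varphi$; $w\models C\varphi$ iff all $R^*$-successors satisfy $\varphi$; atoms, $\bot,\wedge,\vee$ as usual. Sequents: annotated formulae $\varphi^x$,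 $x\in\{\mathsf{u},\mathsf{f}\}$; $\Gamma^-$ the underlying formulae; $K_a\Gamma=\{(K_a\psi)^x:\psi^x\in\Gamma\}$; a sequent $\Gamma\Rightarrow\Delta$ has finite sets, all of $\Gamma$ unfocused, at most one focused formula in $\Delta$, of form $C\psi$ or $K_aC\psi$; valid over a class if $\bigwedge\Gamma^-\to\bigvee\Delta^-$ is. Rules of $\mathrm{cICKS5}$ (premises / conclusion; $x\in\{\mathsf{u},\mathsf{f}\}$; premises and conclusion must be sequents): id: $\Gamma,\varphi^{\mathsf{u}}\Rightarrow\varphi^x,\Delta$; $\bot$: $\Gamma,\bot^{\mathsf{u}}\Rightarrow\Delta$; $\wedge$L: $\Gamma,\varphi^{\mathsf{u}},\psi^{\mathsf{u}}\Rightarrow\Delta$ / $\Gamma,(\varphi\wedge\psi)^{\mathsf{u}}\Rightarrow\Delta$; $\wedge$R: $\Gamma\Rightarrow\varphi^{\mathsf{u}},\Delta$, $\Gamma\Rightarrow\psi^{\mathsf{u}},\Delta$ / $\Gamma\Rightarrow(\varphi\wedge\psi)^{\mathsf{u}},\Delta$; $\vee$L: $\Gamma,\varphi^{\mathsf{u}}\Rightarrow\Delta$, $\Gamma,\psi^{\mathsf{u}}\Rightarrow\Delta$ / $\Gamma,(\varphi\vee\psi)^{\mathsf{u}}\Rightarrow\Delta$; $\vee$R: $\Gamma\Rightarrow\varphi^{\mathsf{u}},\psi^{\mathsf{u}},\Delta$ / $\Gamma\Rightarrow(\varphi\vee\psi)^{\mathsf{u}},\Delta$; $\to$L: $\Gamma\Rightarrow\varphi^{\mathsf{u}},\Delta$,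 $\Gamma,\psi^{\mathsf{u}}\Rightarrow\Delta$ / $\Gamma,(\varphi\to\psi)^{\mathsf{u}}\Rightarrow\Delta$; $\to$R: $\Gamma,\varphi^{\mathsf{u}}\Rightarrow\psi^{\mathsf{u}}$ / $\Gamma\Rightarrow(\varphi\to\psi)^{\mathsf{u}},\Delta$; u: $\Gamma\Rightarrow\varphi^{\mathsf{u}},\Delta$ / $\Gamma\Rightarrow\varphi^{\mathsf{f}},\Delta$; f: $\Gamma\Rightarrow\varphi^{\mathsf{f}},\Delta$ / $\Gamma\Rightarrow\varphi^{\mathsf{u}},\Delta$; $\mathsf{T}_a$: $\Gamma,\varphi^{\mathsf{u}}\Rightarrow\Delta$ / $\Gamma,(K_a\varphi)^{\mathsf{u}}\Rightarrow\Delta$; $\mathsf{S5}_a$: $K_a\Gamma\Rightarrow\varphi^x,K_a\Delta$ / $\Pi,K_a\Gamma\Rightarrow(K_a\varphi)^x,K_a\Delta,\Sigma$; $\mathsf{K}_a{\to}$: $\Gamma,(K_a\varphi)^{\mathsf{u}}\Rightarrow\psi^{\mathsf{u}},\Delta$ / $\Gamma\Rightarrow(K_a\varphi\to\psi)^{\mathsf{u}},\Delta$; CL: $\Gamma,\varphi^{\mathsf{u}},\{(K_aC\varphi)^{\mathsf{u}}\}_a\Rightarrow\Delta$ / $\Gamma,(C\varphi)^{\mathsf{u}}\Rightarrow\Delta$; CR: $\Gamma\Rightarrow\varphi^{\mathsf{u}},\Delta$ and for each $a$, $\Gamma\Rightarrow(K_aC\varphi)^x,\Delta$ / $\Gamma\Rightarrow(C\varphi)^x,\Delta$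 ($C\varphi$ principal); cut: $\Gamma,\varphi^{\mathsf{u}}\Rightarrow\Delta$, $\Gamma\Rightarrow\varphi^{\mathsf{u}},\Delta$ / $\Gamma\Rightarrow\Delta$. A cyclic proof of $\sigma$ is a finite tree labelled by sequents, root $\sigma$, each inner node and its children a rule instance, in which every leaf is an axiom instance (id or $\bot$) or the upper node $v$ of a successful repetition $(u,v)$: distinct nodes with identical sequents, $v$ a descendant of $u$, every sequent on the path from $u$ to $v$ has a focused formula, and this path passes through a CR instance whose principal formula is in focus. *)

theory Defs
  imports Main "HOL-Library.Multiset" "HOL-Library.Sublist"
begin

section \<open>Formulae\<close>

text \<open>The agents are the elements of \<open>'a\<close>, which is required to be of class \<open>finite\<close> wherever that
  matters (HOL types are non-empty); the atoms are the elements of \<open>'p\<close>.\<close>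

datatype ('a, 'p) fm =
    Bot
  | Atom 'p
  | And "('a, 'p) fm" "('a, 'p) fm"
  | Or "('a, 'p) fm" "('a, 'p) fm"
  | Imp "('a, 'p) fm" "('a, 'p) fm"
  | K 'a "('a, 'p) fm"
  | CK "('a, 'p) fm"

abbreviation Neg :: "('a, 'p) fm \<Rightarrow> ('a, 'p) fm" where
  "Neg \<phi> \<equiv> Imp \<phi> Bot"

definition negation_closed :: "('a, 'p) fm set \<Rightarrow> bool" where
  "negation_closed S \<longleftrightarrow>
     (\<forall>\<phi> \<psi>. And \<phi> \<psi> \<in> S \<longrightarrow> \<phi> \<in> S \<and> \<psi> \<in> S) \<and>
     (\<forall>\<phi> \<psi>. Or \<phi> \<psi> \<in> S \<longrightarrow> \<phi> \<in> S \<and> \<psi> \<in> S) \<and>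
     (\<forall>\<phi> \<psi>. Imp \<phi> \<psi> \<in> S \<longrightarrow> \<phi> \<in> S \<and> \<psi> \<in> S) \<and>
     (\<forall>a \<psi>. K a \<psi> \<in> S \<longrightarrow> \<psi> \<in> S \<and> Neg (K a \<psi>) \<in> S) \<and>
     (\<forall>\<psi>. CK \<psi> \<in> S \<longrightarrow> \<psi> \<in> S \<and> (\<forall>a. K a (CK \<psi>) \<in> S))"


section \<open>Semantics\<close>

record ('w, 'a) frame =
  worlds :: "'w set"
  le :: "('w \<times> 'w) set"
  acc :: "'a \<Rightarrow> ('w \<times> 'w) set"

definition S5_frames :: "('w, 'a) frame set" where
  "S5_frames = {F.
     worlds F \<noteq> {} \<and>
     partial_order_on (worlds F) (le F) \<and>
     (\<forall>a. equiv (worlds F) (acc F a)) \<and>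
     (\<forall>a w v u. (w, v) \<in> le F \<longrightarrow> (v, u) \<in> acc F a \<longrightarrow> (w, u) \<in> acc F a)}"

definition monotone_valuation :: "('w, 'a) frame \<Rightarrow> ('w \<Rightarrow> 'p set) \<Rightarrow> bool" where
  "monotone_valuation F V \<longleftrightarrow> (\<forall>w v. (w, v) \<in> le F \<longrightarrow> V w \<subseteq> V v)"

primrec sat :: "('w, 'a) frame \<Rightarrow> ('w \<Rightarrow> 'p set) \<Rightarrow> 'w \<Rightarrow> ('a, 'p) fm \<Rightarrow> bool" where
  "sat F V w Bot \<longleftrightarrow> False"
| "sat F V w (Atom p) \<longleftrightarrow> p \<in> V w"
| "sat F V w (And \<phi> \<psi>) \<longleftrightarrow> sat F V w \<phi> \<and> sat F V w \<psi>"
| "sat F V w (Or \<phi> \<psi>) \<longleftrightarrow> sat F V w \<phi> \<or> sat F V w \<psi>"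
| "sat F V w (Imp \<phi> \<psi>) \<longleftrightarrow> (\<forall>v. (w, v) \<in> le F \<longrightarrow> sat F V v \<phi> \<longrightarrow> sat F V v \<psi>)"
| "sat F V w (K a \<phi>) \<longleftrightarrow> (\<forall>v. (w, v) \<in> acc F a \<longrightarrow> sat F V v \<phi>)"
| "sat F V w (CK \<phi>) \<longleftrightarrow> (\<forall>v. (w, v) \<in> (\<Union>a. acc F a)\<^sup>* \<longrightarrow> sat F V v \<phi>)"

text \<open>A class of frames is a set of frames whose worlds are drawn from a type \<open>'w\<close>. Since HOL cannot
  quantify over types inside a formula, a hypothesis of validity over all S5 frames is rendered by
  validity over \<open>S5_frames :: ('w, 'a) frame set\<close> for an arbitrary infinite type \<open>'w\<close>: the carrier
  \<open>worlds F\<close> then ranges over all non-empty subsets of \<open>'w\<close>, finite ones included. Validity over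
  S5 frames of every size implies this for each \<open>'w\<close>, so nothing is lost when it is assumed.
  (Finite types \<open>'w\<close> have to be excluded, as they would bound the number of worlds.)\<close>

definition valid_over :: "('w, 'a) frame set \<Rightarrow> ('a, 'p) fm \<Rightarrow> bool" where
  "valid_over \<C> \<phi> \<longleftrightarrow>
     (\<forall>F \<in> \<C>. \<forall>V. monotone_valuation F V \<longrightarrow> (\<forall>w \<in> worlds F. sat F V w \<phi>))"


section \<open>Sequents\<close>

datatype annot = Unfoc | Foc

type_synonym ('a, 'p) afm = "('a, 'p) fm \<times> annot"

datatype ('a, 'p) sequent =
  Sequent (ant: "('a, 'p) afm set") (suc: "('a, 'p) afm set")  (infix "\<turnstile>" 50)

definition is_sequent :: "('a, 'p) sequent \<Rightarrow> bool" where
  "is_sequent s \<longleftrightarrow>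
     finite (ant s) \<and> finite (suc s) \<and>
     (\<forall>\<phi> x. (\<phi>, x) \<in> ant s \<longrightarrow> x = Unfoc) \<and>
     (\<forall>\<phi> \<psi>. (\<phi>, Foc) \<in> suc s \<longrightarrow> (\<psi>, Foc) \<in> suc s \<longrightarrow> \<phi> = \<psi>) \<and>
     (\<forall>\<phi>. (\<phi>, Foc) \<in> suc s \<longrightarrow> (\<exists>\<psi>. \<phi> = CK \<psi> \<or> (\<exists>a. \<phi> = K a (CK \<psi>))))"

definition has_focus :: "('a, 'p) sequent \<Rightarrow> bool" where
  "has_focus s \<longleftrightarrow> (\<exists>\<phi>. (\<phi>, Foc) \<in> suc s)"

definition unannot :: "('a, 'p) afm set \<Rightarrow> ('a, 'p) fm set" where
  "unannot \<Gamma> = fst ` \<Gamma>"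

definition formulae :: "('a, 'p) sequent \<Rightarrow> ('a, 'p) fm set" where
  "formulae s = unannot (ant s) \<union> unannot (suc s)"

definition Cl_neg :: "('a, 'p) sequent \<Rightarrow> ('a, 'p) fm set" where
  "Cl_neg s = \<Inter> {S. negation_closed S \<and> formulae s \<subseteq> S}"

text \<open>Conjunctions and disjunctions of finite sets are formed along an arbitrarily chosen enumeration.\<close>

definition enum_of :: "'b set \<Rightarrow> 'b list" where
  "enum_of S = (SOME xs. set xs = S \<and> distinct xs)"

definition big_And :: "('a, 'p) fm set \<Rightarrow> ('a, 'p) fm" where
  "big_And S = foldr And (enum_of S) (Neg Bot)"

definition big_Or :: "('a, 'p) fm set \<Rightarrow> ('a, 'p) fm" where
  "big_Or S = foldr Or (enum_of S) Bot"

definition sequent_valid_over :: "('w, 'a) frame set \<Rightarrow> ('a, 'p) sequent \<Rightarrow> bool" where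
  "sequent_valid_over \<C> s \<longleftrightarrow>
     valid_over \<C> (Imp (big_And (unannot (ant s))) (big_Or (unannot (suc s))))"


section \<open>The calculus\<close>

definition K_set :: "'a \<Rightarrow> ('a, 'p) afm set \<Rightarrow> ('a, 'p) afm set" where
  "K_set a \<Gamma> = (\<lambda>(\<psi>, x). (K a \<psi>, x)) ` \<Gamma>"

text \<open>Inner nodes of a proof record which rule is applied, because a premise-conclusion pair need not
  determine it. \<open>R_CR x\<close> is the rule CR with the principal formula annotated by \<open>x\<close>.\<close>

datatype rule =
    R_AndL | R_AndR | R_OrL | R_OrR | R_ImpL | R_ImpR | R_u | R_f
  | R_T | R_S5 | R_KImp | R_CL | R_CR annot | R_cut

text \<open>The two predicates below are bare schemata: the side condition that premises and conclusions are
  sequents (in particular finite) is imposed on all nodes of a proof in \<open>cyclic_proof\<close>.\<close>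

inductive axiom_instance :: "('a, 'p) sequent \<Rightarrow> bool" where
  id: "axiom_instance (insert (\<phi>, Unfoc) \<Gamma> \<turnstile> insert (\<phi>, x) \<Delta>)"
| bot: "axiom_instance (insert (Bot, Unfoc) \<Gamma> \<turnstile> \<Delta>)"

inductive rule_instance ::
  "rule \<Rightarrow> ('a::finite, 'p) sequent multiset \<Rightarrow> ('a, 'p) sequent \<Rightarrow> bool" where
  AndL: "rule_instance R_AndL
     {# insert (\<phi>, Unfoc) (insert (\<psi>, Unfoc) \<Gamma>) \<turnstile> \<Delta> #}
     (insert (And \<phi> \<psi>, Unfoc) \<Gamma> \<turnstile> \<Delta>)"
| AndR: "rule_instance R_AndR
     {# \<Gamma> \<turnstile> insert (\<phi>, Unfoc) \<Delta>, \<Gamma> \<turnstile> insert (\<psi>, Unfoc) \<Delta> #}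
     (\<Gamma> \<turnstile> insert (And \<phi> \<psi>, Unfoc) \<Delta>)"
| OrL: "rule_instance R_OrL
     {# insert (\<phi>, Unfoc) \<Gamma> \<turnstile> \<Delta>, insert (\<psi>, Unfoc) \<Gamma> \<turnstile> \<Delta> #}
     (insert (Or \<phi> \<psi>, Unfoc) \<Gamma> \<turnstile> \<Delta>)"
| OrR: "rule_instance R_OrR
     {# \<Gamma> \<turnstile> insert (\<phi>, Unfoc) (insert (\<psi>, Unfoc) \<Delta>) #}
     (\<Gamma> \<turnstile> insert (Or \<phi> \<psi>, Unfoc) \<Delta>)"
| ImpL: "rule_instance R_ImpL
     {# \<Gamma> \<turnstile> insert (\<phi>, Unfoc) \<Delta>, insert (\<psi>, Unfoc) \<Gamma> \<turnstile> \<Delta> #}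
     (insert (Imp \<phi> \<psi>, Unfoc) \<Gamma> \<turnstile> \<Delta>)"
| ImpR: "rule_instance R_ImpR
     {# insert (\<phi>, Unfoc) \<Gamma> \<turnstile> {(\<psi>, Unfoc)} #}
     (\<Gamma> \<turnstile> insert (Imp \<phi> \<psi>, Unfoc) \<Delta>)"
| u: "rule_instance R_u
     {# \<Gamma> \<turnstile> insert (\<phi>, Unfoc) \<Delta> #}
     (\<Gamma> \<turnstile> insert (\<phi>, Foc) \<Delta>)"
| f: "rule_instance R_f
     {# \<Gamma> \<turnstile> insert (\<phi>, Foc) \<Delta> #}
     (\<Gamma> \<turnstile> insert (\<phi>, Unfoc) \<Delta>)"
| T: "rule_instance R_T
     {# insert (\<phi>, Unfoc) \<Gamma> \<turnstile> \<Delta> #}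
     (insert (K a \<phi>, Unfoc) \<Gamma> \<turnstile> \<Delta>)"
| S5: "rule_instance R_S5
     {# K_set a \<Gamma> \<turnstile> insert (\<phi>, x) (K_set a \<Delta>) #}
     (\<Pi> \<union> K_set a \<Gamma> \<turnstile> insert (K a \<phi>, x) (K_set a \<Delta> \<union> \<Sigma>))"
| KImp: "rule_instance R_KImp
     {# insert (K a \<phi>, Unfoc) \<Gamma> \<turnstile> insert (\<psi>, Unfoc) \<Delta> #}
     (\<Gamma> \<turnstile> insert (Imp (K a \<phi>) \<psi>, Unfoc) \<Delta>)"
| CL: "rule_instance R_CL
     {# insert (\<phi>, Unfoc) (range (\<lambda>a. (K a (CK \<phi>), Unfoc)) \<union> \<Gamma>) \<turnstile> \<Delta> #}
     (insert (CK \<phi>, Unfoc) \<Gamma> \<turnstile> \<Delta>)"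
| CR: "rule_instance (R_CR x)
     (add_mset (\<Gamma> \<turnstile> insert (\<phi>, Unfoc) \<Delta>)
        (image_mset (\<lambda>a. \<Gamma> \<turnstile> insert (K a (CK \<phi>), x) \<Delta>) (mset_set UNIV)))
     (\<Gamma> \<turnstile> insert (CK \<phi>, x) \<Delta>)"
| cut: "rule_instance R_cut
     {# insert (\<phi>, Unfoc) \<Gamma> \<turnstile> \<Delta>, \<Gamma> \<turnstile> insert (\<phi>, Unfoc) \<Delta> #}
     (\<Gamma> \<turnstile> \<Delta>)"


section \<open>Cyclic proofs\<close>

datatype ('a, 'p) ptree =
    Leaf "('a, 'p) sequent"
  | Inner "('a, 'p) sequent" rule "('a, 'p) ptree list"

primrec root :: "('a, 'p) ptree \<Rightarrow> ('a, 'p) sequent" where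
  "root (Leaf s) = s"
| "root (Inner s r ts) = s"

text \<open>Nodes are addressed by the list of child indices leading to them from the root, so that
  descendants of a node correspond to extensions of its address.\<close>

fun subtree :: "('a, 'p) ptree \<Rightarrow> nat list \<Rightarrow> ('a, 'p) ptree option" where
  "subtree t [] = Some t"
| "subtree (Leaf s) (i # p) = None"
| "subtree (Inner s r ts) (i # p) = (if i < length ts then subtree (ts ! i) p else None)"

definition nodes :: "('a, 'p) ptree \<Rightarrow> nat list set" where
  "nodes t = {p. subtree t p \<noteq> None}"

definition label :: "('a, 'p) ptree \<Rightarrow> nat list \<Rightarrow> ('a, 'p) sequent" where
  "label t p = root (the (subtree t p))"

definition successful_repetition :: "('a, 'p) ptree \<Rightarrow> nat list \<Rightarrow> nat list \<Rightarrow> bool" where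
  "successful_repetition t u v \<longleftrightarrow>
     u \<in> nodes t \<and> v \<in> nodes t \<and> strict_prefix u v \<and> label t u = label t v \<and>
     (\<forall>w. prefix u w \<and> prefix w v \<longrightarrow> has_focus (label t w)) \<and>
     (\<exists>w s ts. prefix u w \<and> strict_prefix w v \<and> subtree t w = Some (Inner s (R_CR Foc) ts))"

definition cyclic_proof :: "('a::finite, 'p) ptree \<Rightarrow> ('a, 'p) sequent \<Rightarrow> bool" where
  "cyclic_proof t \<sigma> \<longleftrightarrow>
     root t = \<sigma> \<and>
     (\<forall>p \<in> nodes t. is_sequent (label t p)) \<and>
     (\<forall>p s r ts. subtree t p = Some (Inner s r ts) \<longrightarrow>
        rule_instance r (mset (map root ts)) s) \<and>
     (\<forall>p s. subtree t p = Some (Leaf s) \<longrightarrow>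
        axiom_instance s \<or> (\<exists>u. successful_repetition t u p))"

end

(* The worlds of a finite canonical model are the subsets w of the closure for which the sequent with
   w on the left and the rest of the closure on the right has no cyclic proof; analytic cuts extend
   every unprovable sequent to such a w. Worlds are ordered by inclusion, and two of them are related
   by an agent a if they contain the same formulae K a. Since the closure contains the negation of
   each K a formula, the rule K-> makes inclusion contained in all these relations.
   The loops are needed only for CK phi: if phi belongs to every world reachable from w, put CK phi
   in focus and repeat CR, S5 and cuts. Every branch ends in a provable sequent or passes through the
   focused sequents of reachable worlds, of which there are finitely many, so that one is repeated. *)

theory Submission
  imports Defs
begin

section \<open>The closure\<close>

lemma negation_closedD:
  assumes "negation_closed S"
  shows "And \<phi> \<psi> \<in> S \<Longrightarrow> \<phi> \<in> S \<and> \<psi> \<in> S"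
    and "Or \<phi> \<psi> \<in> S \<Longrightarrow> \<phi> \<in> S \<and> \<psi> \<in> S"
    and "Imp \<phi> \<psi> \<in> S \<Longrightarrow> \<phi> \<in> S \<and> \<psi> \<in> S"
    and "K a \<psi> \<in> S \<Longrightarrow> \<psi> \<in> S \<and> Neg (K a \<psi>) \<in> S"
    and "CK \<psi> \<in> S \<Longrightarrow> \<psi> \<in> S \<and> K a (CK \<psi>) \<in> S"
  using assms unfolding negation_closed_def by blast+

lemma negation_closedI:
  assumes "\<And>\<phi> \<psi>. And \<phi> \<psi> \<in> S \<Longrightarrow> \<phi> \<in> S \<and> \<psi> \<in> S"
    and "\<And>\<phi> \<psi>. Or \<phi> \<psi> \<in> S \<Longrightarrow> \<phi> \<in> S \<and> \<psi> \<in> S"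
    and "\<And>\<phi> \<psi>. Imp \<phi> \<psi> \<in> S \<Longrightarrow> \<phi> \<in> S \<and> \<psi> \<in> S"
    and "\<And>a \<psi>. K a \<psi> \<in> S \<Longrightarrow> \<psi> \<in> S \<and> Neg (K a \<psi>) \<in> S"
    and "\<And>a \<psi>. CK \<psi> \<in> S \<Longrightarrow> \<psi> \<in> S \<and> K a (CK \<psi>) \<in> S"
  shows "negation_closed S"
  unfolding negation_closed_def
  by (intro conjI allI impI; erule assms assms[THEN conjunct1] assms[THEN conjunct2])

text \<open>A finite negation closed set around one formula, used as an upper bound for
  \<open>Cl_neg\<close>. Negations are added to formulae \<open>K a \<psi>\<close> only and bring in
  nothing further but \<open>Bot\<close>, so the process stops; the clause for \<open>CK\<close> is
  finite because there are finitely many agents.\<close>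

primrec fm_closure :: "('a, 'p) fm \<Rightarrow> ('a, 'p) fm set" where
  "fm_closure Bot = {Bot}"
| "fm_closure (Atom p) = {Atom p}"
| "fm_closure (And \<phi> \<psi>) = insert (And \<phi> \<psi>) (fm_closure \<phi> \<union> fm_closure \<psi>)"
| "fm_closure (Or \<phi> \<psi>) = insert (Or \<phi> \<psi>) (fm_closure \<phi> \<union> fm_closure \<psi>)"
| "fm_closure (Imp \<phi> \<psi>) = insert (Imp \<phi> \<psi>) (fm_closure \<phi> \<union> fm_closure \<psi>)"
| "fm_closure (K a \<phi>) = {K a \<phi>, Neg (K a \<phi>), Bot} \<union> fm_closure \<phi>"
| "fm_closure (CK \<phi>) =
     {CK \<phi>, Bot} \<union> range (\<lambda>a. K a (CK \<phi>)) \<union> range (\<lambda>a. Neg (K a (CK \<phi>))) \<union> fm_closure \<phi>"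

lemma fm_closure_refl: "\<phi> \<in> fm_closure \<phi>"
  by (cases \<phi>) auto

lemma finite_fm_closure: "finite (fm_closure (\<phi> :: ('a::finite, 'p) fm))"
  by (induction \<phi>) auto

lemma negation_closed_fm_closure: "negation_closed (fm_closure \<chi>)"
proof (rule negation_closedI)
  show "And \<phi> \<psi> \<in> fm_closure \<chi> \<Longrightarrow> \<phi> \<in> fm_closure \<chi> \<and> \<psi> \<in> fm_closure \<chi>" for \<phi> \<psi>
    by (induction \<chi>) (auto simp: fm_closure_refl)
  show "Or \<phi> \<psi> \<in> fm_closure \<chi> \<Longrightarrow> \<phi> \<in> fm_closure \<chi> \<and> \<psi> \<in> fm_closure \<chi>" for \<phi> \<psi>
    by (induction \<chi>) (auto simp: fm_closure_refl)
  show "Imp \<phi> \<psi> \<in> fm_closure \<chi> \<Longrightarrow> \<phi> \<in> fm_closure \<chi> \<and> \<psi> \<in> fm_closure \<chi>" for \<phi> \<psi>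
    by (induction \<chi>) (auto simp: fm_closure_refl)
  show "K a \<psi> \<in> fm_closure \<chi> \<Longrightarrow> \<psi> \<in> fm_closure \<chi> \<and> Neg (K a \<psi>) \<in> fm_closure \<chi>"
    for a \<psi>
    by (induction \<chi>) (auto simp: fm_closure_refl)
  show "CK \<psi> \<in> fm_closure \<chi> \<Longrightarrow> \<psi> \<in> fm_closure \<chi> \<and> K a (CK \<psi>) \<in> fm_closure \<chi>"
    for a \<psi>
    by (induction \<chi>) (auto simp: fm_closure_refl)
qed

lemma formulae_subset_Cl_neg: "formulae s \<subseteq> Cl_neg s"
  unfolding Cl_neg_def by blast

lemma negation_closed_Inter:
  assumes "\<And>S. S \<in> \<S> \<Longrightarrow> negation_closed S"
  shows "negation_closed (\<Inter> \<S>)"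
proof (rule negation_closedI)
  show "\<phi> \<in> \<Inter> \<S> \<and> \<psi> \<in> \<Inter> \<S>" if "And \<phi> \<psi> \<in> \<Inter> \<S>" for \<phi> \<psi>
    using that by (blast dest: negation_closedD(1)[OF assms])
  show "\<phi> \<in> \<Inter> \<S> \<and> \<psi> \<in> \<Inter> \<S>" if "Or \<phi> \<psi> \<in> \<Inter> \<S>" for \<phi> \<psi>
    using that by (blast dest: negation_closedD(2)[OF assms])
  show "\<phi> \<in> \<Inter> \<S> \<and> \<psi> \<in> \<Inter> \<S>" if "Imp \<phi> \<psi> \<in> \<Inter> \<S>" for \<phi> \<psi>
    using that by (blast dest: negation_closedD(3)[OF assms])
  show "\<psi> \<in> \<Inter> \<S> \<and> Neg (K a \<psi>) \<in> \<Inter> \<S>" if "K a \<psi> \<in> \<Inter> \<S>" for a \<psi>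
    using that by (blast dest: negation_closedD(4)[OF assms])
  show "\<psi> \<in> \<Inter> \<S> \<and> K a (CK \<psi>) \<in> \<Inter> \<S>" if "CK \<psi> \<in> \<Inter> \<S>" for a \<psi>
    using that by (blast dest: negation_closedD(5)[OF assms])
qed

text \<open>Each closure condition has a single formula as its premise, so it passes from the
  members to the union.\<close>

lemma negation_closed_Union:
  assumes "\<And>S. S \<in> \<S> \<Longrightarrow> negation_closed S"
  shows "negation_closed (\<Union> \<S>)"
proof (rule negation_closedI)
  show "\<phi> \<in> \<Union> \<S> \<and> \<psi> \<in> \<Union> \<S>" if "And \<phi> \<psi> \<in> \<Union> \<S>" for \<phi> \<psi>
    using that by (blast dest: negation_closedD(1)[OF assms])
  show "\<phi> \<in> \<Union> \<S> \<and> \<psi> \<in> \<Union> \<S>" if "Or \<phi> \<psi> \<in> \<Union> \<S>" for \<phi> \<psi>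
    using that by (blast dest: negation_closedD(2)[OF assms])
  show "\<phi> \<in> \<Union> \<S> \<and> \<psi> \<in> \<Union> \<S>" if "Imp \<phi> \<psi> \<in> \<Union> \<S>" for \<phi> \<psi>
    using that by (blast dest: negation_closedD(3)[OF assms])
  show "\<psi> \<in> \<Union> \<S> \<and> Neg (K a \<psi>) \<in> \<Union> \<S>" if "K a \<psi> \<in> \<Union> \<S>" for a \<psi>
    using that by (blast dest: negation_closedD(4)[OF assms])
  show "\<psi> \<in> \<Union> \<S> \<and> K a (CK \<psi>) \<in> \<Union> \<S>" if "CK \<psi> \<in> \<Union> \<S>" for a \<psi>
    using that by (blast dest: negation_closedD(5)[OF assms])
qed

lemma negation_closed_Cl_neg: "negation_closed (Cl_neg s)"
  unfolding Cl_neg_def by (rule negation_closed_Inter) simp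

lemma finite_Cl_neg:
  fixes s :: "('a::finite, 'p) sequent"
  assumes "is_sequent s"
  shows "finite (Cl_neg s)"
proof -
  let ?S = "\<Union>\<phi>\<in>formulae s. fm_closure \<phi>"
  have "negation_closed ?S"
    by (rule negation_closed_Union) (use negation_closed_fm_closure in auto)
  moreover have "formulae s \<subseteq> ?S"
    using fm_closure_refl by auto
  ultimately have "Cl_neg s \<subseteq> ?S"
    unfolding Cl_neg_def by blast
  moreover have "finite ?S"
    using assms finite_fm_closure by (auto simp: is_sequent_def formulae_def unannot_def)
  ultimately show ?thesis
    by (rule finite_subset)
qed


section \<open>Provability relative to a history\<close>

text \<open>A history lists the sequents, with the rules applied to them, on the path from the root to the
  current node; \<open>loops H\<close> contains the sequents at which a branch with history \<open>H\<close> may be closed by a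
  successful repetition.\<close>

type_synonym ('a, 'p) history = "(('a, 'p) sequent \<times> rule) list"

definition loops :: "('a, 'p) history \<Rightarrow> ('a, 'p) sequent set" where
  "loops H = {s. \<exists>i < length H. fst (H ! i) = s \<and>
     (\<forall>j. i \<le> j \<and> j < length H \<longrightarrow> has_focus (fst (H ! j))) \<and>
     (\<exists>j. i \<le> j \<and> j < length H \<and> snd (H ! j) = R_CR Foc)}"

lemma loopsI:
  assumes "i < length H" "\<And>k. i \<le> k \<Longrightarrow> k < length H \<Longrightarrow> has_focus (fst (H ! k))"
    and "i \<le> j" "j < length H" "snd (H ! j) = R_CR Foc" "fst (H ! i) = s"
  shows "s \<in> loops H"
  using assms unfolding loops_def by blast

lemma loopsE:
  assumes "s \<in> loops H"
  obtains i j where "i < length H" "\<And>k. i \<le> k \<Longrightarrow> k < length H \<Longrightarrow> has_focus (fst (H ! k))"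
    "i \<le> j" "j < length H" "snd (H ! j) = R_CR Foc" "fst (H ! i) = s"
  using assms unfolding loops_def by blast

text \<open>A successful repetition is focused throughout, so earlier loop targets survive a further
  step when its sequent has a focus.\<close>

lemma loops_snoc:
  assumes "has_focus x"
  shows "loops H \<subseteq> loops (H @ [(x, r)])"
proof
  fix s assume "s \<in> loops H"
  then show "s \<in> loops (H @ [(x, r)])"
  proof (rule loopsE)
    fix i j
    assume *: "i < length H" "\<And>k. i \<le> k \<Longrightarrow> k < length H \<Longrightarrow> has_focus (fst (H ! k))"
      "i \<le> j" "j < length H" "snd (H ! j) = R_CR Foc" "fst (H ! i) = s"
    then show ?thesis
      using assms by (intro loopsI[of i _ j]) (auto simp: nth_append)
  qed
qed

text \<open>A focused CR step makes its own conclusion a target: the companion and the required CR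
  instance are the same node.\<close>

lemma loops_snoc_CR:
  assumes "has_focus s"
  shows "s \<in> loops (H @ [(s, R_CR Foc)])"
  using assms by (intro loopsI[of "length H" _ "length H"]) (auto simp: nth_append)

lemma loops_append: "loops H \<subseteq> loops (H' @ H)"
proof
  fix s assume "s \<in> loops H"
  then show "s \<in> loops (H' @ H)"
  proof (rule loopsE)
    fix i j
    assume *: "i < length H" "\<And>k. i \<le> k \<Longrightarrow> k < length H \<Longrightarrow> has_focus (fst (H ! k))"
      "i \<le> j" "j < length H" "snd (H ! j) = R_CR Foc" "fst (H ! i) = s"
    then show ?thesis
      by (intro loopsI[of "length H' + i" _ "length H' + j"]) (auto simp: nth_append)
  qed
qed

text \<open>Being inductive, this admits finite derivations only; circularity enters solely through
  \<open>prov_loop\<close>. The premises of a rule see its conclusion at the end of their history,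
  and every clause demands a sequent within \<open>S\<close>, so that all nodes of the resulting
  tree are analytic.\<close>

inductive prov ::
  "('a::finite, 'p) fm set \<Rightarrow> ('a, 'p) history \<Rightarrow> ('a, 'p) sequent \<Rightarrow> bool" for S where
  prov_axiom: "is_sequent s \<Longrightarrow> formulae s \<subseteq> S \<Longrightarrow> axiom_instance s \<Longrightarrow> prov S H s"
| prov_loop: "is_sequent s \<Longrightarrow> formulae s \<subseteq> S \<Longrightarrow> s \<in> loops H \<Longrightarrow> prov S H s"
| prov_rule: "is_sequent s \<Longrightarrow> formulae s \<subseteq> S \<Longrightarrow> rule_instance r M s \<Longrightarrow>
    (\<And>s'. s' \<in># M \<Longrightarrow> prov S (H @ [(s, r)]) s') \<Longrightarrow> prov S H s"

text \<open>Success of a loop depends only on the history from its companion on, so a longer past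
  takes no loop away.\<close>

lemma prov_mono: "prov S H s \<Longrightarrow> prov S (H' @ H) s"
proof (induction rule: prov.induct)
  case (prov_loop s H)
  then show ?case
    using loops_append by (blast intro: prov.prov_loop)
next
  case (prov_rule s r M H)
  show ?case
    by (rule prov.prov_rule[OF prov_rule(1-3)]) (use prov_rule in auto)
qed (blast intro: prov.prov_axiom)

text \<open>A premise provable from the empty history brings its own companions, so its derivation
  fits above any conclusion. Hence plain provability is closed under the rules.\<close>

lemma prov_rule_closed:
  assumes "rule_instance r M s" "is_sequent s" "formulae s \<subseteq> S" "\<And>s'. s' \<in># M \<Longrightarrow> prov S [] s'"
  shows "prov S H s"
  by (rule prov_rule[OF assms(2,3,1)]) (use prov_mono[OF assms(4)] in fastforce)

section \<open>From derivations with histories to cyclic proof trees\<close>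

fun path :: "('a, 'p) ptree \<Rightarrow> nat list \<Rightarrow> ('a, 'p) history" where
  "path t [] = []"
| "path (Leaf s) (i # p) = []"
| "path (Inner s r ts) (i # p) = (s, r) # path (ts ! i) p"

text \<open>The node \<open>p\<close> itself is not recorded, only its proper ancestors, which is
  why path and address are equally long. The empty value of \<open>path\<close> below a leaf
  concerns addresses outside the tree.\<close>

lemma path_nth:
  assumes "subtree t p \<noteq> None"
  shows "length (path t p) = length p \<and>
    (\<forall>j < length p. \<exists>s r ts. subtree t (take j p) = Some (Inner s r ts) \<and> path t p ! j = (s, r))"
  using assms
proof (induction t p rule: path.induct)
  case (3 s r ts i p)
  then have "subtree (ts ! i) p \<noteq> None" "i < length ts"
    by (auto split: if_splits)
  with "3.IH" show ?case
    by (auto simp: less_Suc_eq_0_disj)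
qed auto

text \<open>A tree for a sequent that is provable with history \<open>H\<close>, to be attached at the end of a path
  described by \<open>H\<close>; its leaves may loop back to nodes of that path.\<close>

definition tree_for ::
  "('a::finite, 'p) fm set \<Rightarrow> ('a, 'p) history \<Rightarrow> ('a, 'p) sequent \<Rightarrow> ('a, 'p) ptree \<Rightarrow> bool" where
  "tree_for S H s t \<longleftrightarrow> root t = s \<and>
     (\<forall>p \<in> nodes t. is_sequent (label t p) \<and> formulae (label t p) \<subseteq> S) \<and>
     (\<forall>p s r ts. subtree t p = Some (Inner s r ts) \<longrightarrow> rule_instance r (mset (map root ts)) s) \<and>
     (\<forall>p s. subtree t p = Some (Leaf s) \<longrightarrow> axiom_instance s \<or> s \<in> loops (H @ path t p))"

lemma subtree_Leaf: "subtree (Leaf s) p = (if p = [] then Some (Leaf s) else None)"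
  by (cases p) auto

lemma tree_for_Leaf:
  assumes "is_sequent s" "formulae s \<subseteq> S" "axiom_instance s \<or> s \<in> loops H"
  shows "tree_for S H s (Leaf s)"
  using assms by (auto simp: tree_for_def nodes_def label_def subtree_Leaf split: if_splits)

lemma tree_for_Inner:
  assumes s: "is_sequent s" "formulae s \<subseteq> S"
    and rule: "rule_instance r (mset (map root ts)) s"
    and sub: "\<And>t. t \<in> set ts \<Longrightarrow> tree_for S (H @ [(s, r)]) (root t) t"
  shows "tree_for S H s (Inner s r ts)"
proof -
  let ?t = "Inner s r ts"
  have ex: "tree_for S (H @ [(s, r)]) (root (ts ! i)) (ts ! i)" if "i < length ts" for i
    using sub that by auto
  have "is_sequent (label ?t p) \<and> formulae (label ?t p) \<subseteq> S" if "p \<in> nodes ?t" for p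
  proof (cases p)
    case Nil
    then show ?thesis using s by (simp add: label_def)
  next
    case (Cons i q)
    with that have "i < length ts" "q \<in> nodes (ts ! i)" "label ?t p = label (ts ! i) q"
      by (auto simp: nodes_def label_def split: if_splits)
    then show ?thesis using ex unfolding tree_for_def by metis
  qed
  moreover have "rule_instance r' (mset (map root ts')) s'"
    if "subtree ?t p = Some (Inner s' r' ts')" for p s' r' ts'
  proof (cases p)
    case Nil
    then show ?thesis using rule that by simp
  next
    case (Cons i q)
    with that have "i < length ts" "subtree (ts ! i) q = Some (Inner s' r' ts')"
      by (auto split: if_splits)
    then show ?thesis using ex unfolding tree_for_def by metis
  qed
  moreover have "axiom_instance s' \<or> s' \<in> loops (H @ path ?t p)"
    if "subtree ?t p = Some (Leaf s')" for p s'
  proof (cases p)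
    case Nil
    then show ?thesis using that by simp
  next
    case (Cons i q)
    with that have "i < length ts" "subtree (ts ! i) q = Some (Leaf s')"
      by (auto split: if_splits)
    \<comment> \<open>The entry of the new root moves from the end of the history to the front of
      the path; the two concatenations coincide.\<close>
    then have "axiom_instance s' \<or> s' \<in> loops ((H @ [(s, r)]) @ path (ts ! i) q)"
      using ex unfolding tree_for_def by metis
    then show ?thesis using Cons by simp
  qed
  ultimately show ?thesis
    unfolding tree_for_def by auto
qed

lemma prov_tree: "prov S H s \<Longrightarrow> \<exists>t. tree_for S H s t"
proof (induction rule: prov.induct)
  case (prov_rule s r M H)
  then have "\<forall>s'. \<exists>t. s' \<in># M \<longrightarrow> tree_for S (H @ [(s, r)]) s' t"
    by blast
  then obtain g where g: "\<And>s'. s' \<in># M \<Longrightarrow> tree_for S (H @ [(s, r)]) s' (g s')"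
    by metis
  \<comment> \<open>Any ordering of the premises will do; equal premises receive the same
    tree.\<close>
  obtain ss where ss: "mset ss = M"
    using ex_mset by blast
  have root_g: "root (g s') = s'" if "s' \<in> set ss" for s'
    using g that unfolding tree_for_def ss[symmetric] by simp
  have "map root (map g ss) = ss"
    using root_g by (simp add: map_idI)
  then have "tree_for S H s (Inner s r (map g ss))"
    using prov_rule ss g root_g by (intro tree_for_Inner) auto
  then show ?case ..
qed (blast intro: tree_for_Leaf)+

text \<open>With an empty initial history a leaf \<open>p\<close> can only loop back into the tree
  itself: index \<open>i\<close> of its path yields the companion \<open>take i p\<close>, and the
  recorded \<open>R_CR Foc\<close> entry is the focused CR instance.\<close>

lemma prov_cyclic_proof:
  assumes "prov S [] s"
  shows "\<exists>t. cyclic_proof t s \<and> (\<forall>p \<in> nodes t. formulae (label t p) \<subseteq> S)"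
proof -
  obtain t where t: "tree_for S [] s t"
    using prov_tree[OF assms] ..
  have "successful_repetition t (take i p) p"
    if p: "subtree t p = Some (Leaf s')"
      and i: "i < length (path t p)" "fst (path t p ! i) = s'"
      and foc: "\<forall>j. i \<le> j \<and> j < length (path t p) \<longrightarrow> has_focus (fst (path t p ! j))"
      and j: "i \<le> j" "j < length (path t p)" "snd (path t p ! j) = R_CR Foc"
    for p s' i j
  proof -
    have len: "length (path t p) = length p"
      and nth: "\<And>k. k < length p \<Longrightarrow>
        \<exists>s r ts. subtree t (take k p) = Some (Inner s r ts) \<and> path t p ! k = (s, r)"
      using path_nth[of t p] p by auto
    have label_nth: "label t (take k p) = fst (path t p ! k)" if "k < length p" for k
      using nth[OF that] by (auto simp: label_def)
    have "has_focus (label t w)" if w: "prefix (take i p) w" "prefix w p" for w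
    proof (cases "length w < length p")
      case True
      have "w = take (length w) p"
        using w(2) by (auto simp: prefix_def)
      moreover have "i \<le> length w"
        using prefix_length_le[OF w(1)] i len by simp
      ultimately show ?thesis
        using True label_nth foc len by metis
    next
      case False
      \<comment> \<open>The path has no entry for the leaf, but the leaf carries the same sequent as
        entry \<open>i\<close>, which is focused.\<close>
      then have "w = p"
        using w(2) by (auto simp: prefix_def)
      then show ?thesis
        using p i foc by (auto simp: label_def)
    qed
    moreover have "strict_prefix (take k p) p" if "k < length p" for k
      using that by (metis length_take less_irrefl min.absorb4 strict_prefixI take_is_prefix)
    moreover have "prefix (take i p) (take j p)"
      by (metis j(1) min.absorb1 take_is_prefix take_take)
    moreover have "\<exists>s ts. subtree t (take j p) = Some (Inner s (R_CR Foc) ts)"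
      using nth[of j] j len by auto
    moreover have "label t (take i p) = label t p"
      using label_nth[of i] i len p by (auto simp: label_def)
    ultimately show ?thesis
      unfolding successful_repetition_def nodes_def
      using nth[of i] i j len p by auto
  qed
  then have "axiom_instance s' \<or> (\<exists>u. successful_repetition t u p)"
    if "subtree t p = Some (Leaf s')" for p s'
    using t that unfolding tree_for_def loops_def append_Nil mem_Collect_eq by metis
  then show ?thesis
    using t unfolding cyclic_proof_def tree_for_def by blast
qed


section \<open>Saturated sequents\<close>

definition unf :: "('a, 'p) fm set \<Rightarrow> ('a, 'p) afm set" where
  "unf A = (\<lambda>\<phi>. (\<phi>, Unfoc)) ` A"

lemma mem_unf [simp]: "(\<phi>, x) \<in> unf A \<longleftrightarrow> \<phi> \<in> A \<and> x = Unfoc"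
  by (auto simp: unf_def)

lemma insert_unf: "insert (\<phi>, Unfoc) (unf A) = unf (insert \<phi> A)"
  by (auto simp: unf_def)

lemma finite_unf [simp]: "finite A \<Longrightarrow> finite (unf A)"
  by (simp add: unf_def)

lemma unannot_Un [simp]: "unannot (A \<union> B) = unannot A \<union> unannot B"
  by (auto simp: unannot_def)

lemma unannot_insert [simp]: "unannot (insert (\<phi>, x) A) = insert \<phi> (unannot A)"
  by (auto simp: unannot_def)

lemma unannot_unf [simp]: "unannot (unf A) = A"
  by (force simp: unf_def unannot_def)

lemma unannot_empty [simp]: "unannot {} = {}"
  by (simp add: unannot_def)

lemma K_set_unf: "K_set a (unf A) = unf (K a ` A)"
  by (auto simp: K_set_def unf_def image_def)

text \<open>The optional focused formula of a succedent is kept apart from the unfocused rest, so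
  that one saturation argument serves sequents with and without focus.\<close>

definition focus_set :: "('a, 'p) fm set \<Rightarrow> ('a, 'p) afm set \<Rightarrow> bool" where
  "focus_set S E \<longleftrightarrow> E = {} \<or>
     (\<exists>\<phi>. E = {(\<phi>, Foc)} \<and> \<phi> \<in> S \<and> (\<exists>\<psi>. \<phi> = CK \<psi> \<or> (\<exists>a. \<phi> = K a (CK \<psi>))))"

locale finite_closure =
  fixes S :: "('a::finite, 'p) fm set"
  assumes finite_S: "finite S"
    and closed_S: "negation_closed S"
begin

lemmas closedD = negation_closedD[OF closed_S]

lemma unf_sequent:
  assumes "A \<subseteq> S" "B \<subseteq> S" "focus_set S E"
  shows "is_sequent (unf A \<turnstile> unf B \<union> E)" "formulae (unf A \<turnstile> unf B \<union> E) \<subseteq> S"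
  using assms finite_S finite_subset[of _ S]
  by (auto simp: is_sequent_def formulae_def focus_set_def)

lemma prov_id:
  assumes "A \<subseteq> S" "B \<subseteq> S" "focus_set S E" "\<phi> \<in> A" "(\<phi>, x) \<in> unf B \<union> E"
  shows "prov S H (unf A \<turnstile> unf B \<union> E)"
proof (rule prov_axiom[OF unf_sequent[OF assms(1-3)]])
  have "unf A = insert (\<phi>, Unfoc) (unf A)" "unf B \<union> E = insert (\<phi>, x) (unf B \<union> E)"
    using assms by auto
  then show "axiom_instance (unf A \<turnstile> unf B \<union> E)"
    by (metis axiom_instance.id)
qed

text \<open>Analytic cuts decide the formulae of \<open>S\<close> one by one. A branch that puts a
  formula on both sides is an identity axiom; the others end in a partition of \<open>S\<close>,
  where \<open>sat\<close> applies. The set \<open>L\<close> holds loop targets that must remain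
  available above the cuts.\<close>

lemma prov_saturate:
  assumes "A \<subseteq> S" "B \<subseteq> S" "focus_set S E" "L \<subseteq> loops H" "E = {} \<Longrightarrow> L = {}"
    and sat: "\<And>H w. L \<subseteq> loops H \<Longrightarrow> A \<subseteq> w \<Longrightarrow> w \<subseteq> S \<Longrightarrow> w \<inter> B = {} \<Longrightarrow>
      prov S H (unf w \<turnstile> unf (S - w) \<union> E)"
  shows "prov S H (unf A \<turnstile> unf B \<union> E)"
  using assms
proof (induction "card (S - (A \<union> B))" arbitrary: A B H rule: less_induct)
  case less
  show ?case
  proof (cases "S \<subseteq> A \<union> B")
    case True
    show ?thesis
    proof (cases "A \<inter> B = {}")
      case True
      with \<open>S \<subseteq> A \<union> B\<close> less.prems have "B = S - A"
        by blast
      then show ?thesis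
        using less.prems by auto
    next
      case False
      then obtain \<phi> where "\<phi> \<in> A" "\<phi> \<in> B"
        by blast
      with less.prems show ?thesis
        by (intro prov_id[where \<phi> = \<phi> and x = Unfoc]) auto
    qed
  next
    case False
    then obtain \<chi> where \<chi>: "\<chi> \<in> S" "\<chi> \<notin> A" "\<chi> \<notin> B"
      by blast
    let ?s = "unf A \<turnstile> unf B \<union> E"
    let ?H = "H @ [(?s, R_cut)]"
    \<comment> \<open>The cut conclusion contains \<open>E\<close>, whose focus preserves the
      targets; for empty \<open>E\<close> there are none to preserve.\<close>
    have L: "L \<subseteq> loops ?H"
    proof (cases "E = {}")
      case False
      then have "has_focus ?s"
        using less.prems(3) by (auto simp: focus_set_def has_focus_def)
      then show ?thesis
        using loops_snoc less.prems(4) by blast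
    qed (use less.prems in simp)
    have card: "card (S - (insert \<chi> A \<union> B)) < card (S - (A \<union> B))"
      "card (S - (A \<union> insert \<chi> B)) < card (S - (A \<union> B))"
      by (rule psubset_card_mono; use \<chi> finite_S in auto)+
    have "prov S ?H (unf (insert \<chi> A) \<turnstile> unf B \<union> E)"
      by (rule less.hyps[OF card(1) _ _ less.prems(3) L less.prems(5)])
        (use \<chi> less.prems(1,2) in \<open>auto intro: less.prems(6)\<close>)
    moreover have "prov S ?H (unf A \<turnstile> unf (insert \<chi> B) \<union> E)"
      by (rule less.hyps[OF card(2) _ _ less.prems(3) L less.prems(5)])
        (use \<chi> less.prems(1,2) in \<open>auto intro: less.prems(6)\<close>)
    ultimately show ?thesis
      using unf_sequent[OF less.prems(1-3)]
      by (intro prov_rule[OF _ _ rule_instance.cut[of \<chi>]]) (auto simp flip: insert_unf)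
  qed
qed


section \<open>The canonical model\<close>

definition world :: "('a, 'p) fm set \<Rightarrow> bool" where
  "world w \<longleftrightarrow> w \<subseteq> S \<and> \<not> prov S [] (unf w \<turnstile> unf (S - w))"

text \<open>For a world this is what agent \<open>a\<close> knows there, and equality of these sets
  will be accessibility; for \<open>S - w\<close> it supplies the right context of the S5
  rule.\<close>

definition Kfms :: "'a \<Rightarrow> ('a, 'p) fm set \<Rightarrow> ('a, 'p) fm set" where
  "Kfms a w = {\<psi>. K a \<psi> \<in> w}"

lemma world_subset: "world w \<Longrightarrow> w \<subseteq> S"
  by (simp add: world_def)

text \<open>The Lindenbaum lemma: if every partition of \<open>S\<close> extending the two sides
  were provable, cuts would prove the given sequent.\<close>

lemma world_extends:
  assumes "A \<subseteq> S" "B \<subseteq> S" "\<not> prov S H (unf A \<turnstile> unf B)"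
  shows "\<exists>w. world w \<and> A \<subseteq> w \<and> w \<inter> B = {}"
proof (rule ccontr)
  assume "\<not> ?thesis"
  then have "prov S H' (unf w \<turnstile> unf (S - w) \<union> {})"
    if "A \<subseteq> w" "w \<subseteq> S" "w \<inter> B = {}" for w H'
    using that prov_mono[of S "[]" _ H'] by (auto simp: world_def)
  then have "prov S H (unf A \<turnstile> unf B \<union> {})"
    by (rule prov_saturate[where L = "{}", rotated 5]) (use assms(1,2) in \<open>auto simp: focus_set_def\<close>)
  with assms(3) show False
    by simp
qed

lemma world_rule:
  assumes "world w" "rule_instance r M (unf w \<turnstile> unf (S - w))"
  shows "\<exists>s' \<in># M. \<not> prov S [] s'"
  using assms prov_rule_closed[OF assms(2), of S "[]"]
    unf_sequent[of w "S - w" "{}"] world_subset[OF assms(1)]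
  by (auto simp: world_def focus_set_def)

text \<open>An overlap would be an identity axiom. This turns unprovable premises into membership
  facts: a formula of \<open>S\<close> on the left, opposite \<open>S - w\<close>, must lie in
  \<open>w\<close>.\<close>

lemma unprov_disjoint:
  assumes "\<not> prov S H (unf A \<turnstile> unf B)" "A \<subseteq> S" "B \<subseteq> S"
  shows "A \<inter> B = {}"
proof (rule ccontr)
  assume "A \<inter> B \<noteq> {}"
  then obtain \<phi> where "\<phi> \<in> A" "\<phi> \<in> B" by blast
  then show False
    using prov_id[of A B "{}" \<phi> Unfoc H] assms by (auto simp: focus_set_def)
qed

text \<open>Sets absorb the principal formula, so the rule applies with all of \<open>w\<close> as
  context and the premises lose nothing of it.\<close>

lemma world_ruleL:
  assumes "world w" "\<phi> \<in> w"
    and "\<And>\<Gamma> \<Delta>. rule_instance r (M \<Gamma> \<Delta>) (insert (\<phi>, Unfoc) \<Gamma> \<turnstile> \<Delta>)"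
  shows "\<exists>s' \<in># M (unf w) (unf (S - w)). \<not> prov S [] s'"
  using world_rule[OF assms(1)] assms(2) assms(3)[of "unf w" "unf (S - w)"]
  by (simp add: insert_unf insert_absorb)

lemma world_ruleR:
  assumes "world w" "\<phi> \<in> S" "\<phi> \<notin> w"
    and "\<And>\<Gamma> \<Delta>. rule_instance r (M \<Gamma> \<Delta>) (\<Gamma> \<turnstile> insert (\<phi>, Unfoc) \<Delta>)"
  shows "\<exists>s' \<in># M (unf w) (unf (S - w)). \<not> prov S [] s'"
  using world_rule[OF assms(1)] assms(2,3) assms(4)[of "unf w" "unf (S - w)"]
  by (simp add: insert_unf insert_absorb)

section \<open>Membership conditions for worlds, connective by connective\<close>

lemma world_Bot:
  assumes "world w"
  shows "Bot \<notin> w"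
proof
  assume "Bot \<in> w"
  then have "unf w = insert (Bot, Unfoc) (unf w)"
    by auto
  then have "axiom_instance (unf w \<turnstile> unf (S - w))"
    by (metis axiom_instance.bot)
  then show False
    using assms unf_sequent[of w "S - w" "{}"]
    by (auto simp: world_def focus_set_def intro: prov_axiom)
qed

lemma world_And:
  assumes "world w" "And \<phi> \<psi> \<in> S"
  shows "And \<phi> \<psi> \<in> w \<longleftrightarrow> \<phi> \<in> w \<and> \<psi> \<in> w"
proof
  assume "And \<phi> \<psi> \<in> w"
  from world_ruleL[OF assms(1) this AndL]
  have "\<not> prov S [] (unf (insert \<phi> (insert \<psi> w)) \<turnstile> unf (S - w))"
    by (simp add: insert_unf)
  from unprov_disjoint[OF this] show "\<phi> \<in> w \<and> \<psi> \<in> w"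
    using world_subset[OF assms(1)] closedD(1)[OF assms(2)] by auto
next
  assume *: "\<phi> \<in> w \<and> \<psi> \<in> w"
  show "And \<phi> \<psi> \<in> w"
  proof (rule ccontr)
    assume "And \<phi> \<psi> \<notin> w"
    from world_ruleR[OF assms(1,2) this AndR]
    have "\<not> prov S [] (unf w \<turnstile> unf (insert \<phi> (S - w))) \<or>
          \<not> prov S [] (unf w \<turnstile> unf (insert \<psi> (S - w)))"
      by (auto simp: insert_unf)
    then show False
      using unprov_disjoint[of "[]" w] * world_subset[OF assms(1)] by blast
  qed
qed

lemma world_Or:
  assumes "world w" "Or \<phi> \<psi> \<in> S"
  shows "Or \<phi> \<psi> \<in> w \<longleftrightarrow> \<phi> \<in> w \<or> \<psi> \<in> w"
proof
  assume "Or \<phi> \<psi> \<in> w"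
  from world_ruleL[OF assms(1) this OrL]
  have "\<not> prov S [] (unf (insert \<phi> w) \<turnstile> unf (S - w)) \<or>
        \<not> prov S [] (unf (insert \<psi> w) \<turnstile> unf (S - w))"
    by (auto simp: insert_unf)
  then show "\<phi> \<in> w \<or> \<psi> \<in> w"
    using unprov_disjoint[of "[]" _ "S - w"] world_subset[OF assms(1)] closedD(2)[OF assms(2)]
    by blast
next
  assume *: "\<phi> \<in> w \<or> \<psi> \<in> w"
  show "Or \<phi> \<psi> \<in> w"
  proof (rule ccontr)
    assume "Or \<phi> \<psi> \<notin> w"
    from world_ruleR[OF assms(1,2) this OrR]
    have "\<not> prov S [] (unf w \<turnstile> unf (insert \<phi> (insert \<psi> (S - w))))"
      by (auto simp: insert_unf)
    from unprov_disjoint[OF this] show False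
      using * world_subset[OF assms(1)] closedD(2)[OF assms(2)] by auto
  qed
qed

lemma world_ImpL:
  assumes "world w" "Imp \<phi> \<psi> \<in> w" "\<phi> \<in> w"
  shows "\<psi> \<in> w"
proof -
  have sub: "w \<subseteq> S" "\<phi> \<in> S" "\<psi> \<in> S"
    using world_subset[OF assms(1)] closedD(3)[of \<phi> \<psi>] assms by auto
  from world_ruleL[OF assms(1,2) ImpL]
  have "\<not> prov S [] (unf w \<turnstile> unf (insert \<phi> (S - w))) \<or>
        \<not> prov S [] (unf (insert \<psi> w) \<turnstile> unf (S - w))"
    by (auto simp: insert_unf)
  then show ?thesis
    using unprov_disjoint[of "[]" w "insert \<phi> (S - w)"]
      unprov_disjoint[of "[]" "insert \<psi> w" "S - w"] sub assms by blast
qed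

text \<open>The rule discards the right context, so the unprovable premise constrains a world above
  \<open>w\<close> rather than \<open>w\<close> itself.\<close>

lemma world_ImpR:
  assumes "world w" "Imp \<phi> \<psi> \<in> S" "Imp \<phi> \<psi> \<notin> w"
  shows "\<exists>v. world v \<and> w \<subseteq> v \<and> \<phi> \<in> v \<and> \<psi> \<notin> v"
proof -
  from world_ruleR[OF assms ImpR]
  have "\<not> prov S [] (unf (insert \<phi> w) \<turnstile> unf {\<psi>})"
    by (auto simp: insert_unf unf_def)
  from world_extends[OF _ _ this] show ?thesis
    using world_subset[OF assms(1)] closedD(3)[OF assms(2)] by auto
qed

text \<open>Unlike \<open>ImpR\<close>, the rule \<open>KImp\<close> keeps the right context. If the
  negation were absent too, its premise would have \<open>K a \<psi>\<close> on both sides.\<close>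

lemma world_Neg_K:
  assumes "world w" "K a \<psi> \<in> S" "K a \<psi> \<notin> w"
  shows "Neg (K a \<psi>) \<in> w"
proof (rule ccontr)
  assume *: "Neg (K a \<psi>) \<notin> w"
  have S: "Neg (K a \<psi>) \<in> S" "Bot \<in> S"
    using closedD(4)[OF assms(2)] closedD(3) by blast+
  from world_ruleR[OF assms(1) S(1) * KImp]
  have "\<not> prov S [] (unf (insert (K a \<psi>) w) \<turnstile> unf (insert Bot (S - w)))"
    by (auto simp: insert_unf)
  from unprov_disjoint[OF this] show False
    using world_subset[OF assms(1)] assms S by auto
qed

text \<open>A formula \<open>K a \<psi>\<close> new in \<open>v\<close> would meet its negation,
  inherited from \<open>w\<close>. Inclusion thus lies inside every accessibility relation, which
  yields triangle confluence.\<close>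

lemma world_mono_Kfms:
  assumes "world w" "world v" "w \<subseteq> v"
  shows "Kfms a w = Kfms a v"
proof -
  have "K a \<psi> \<in> w" if "K a \<psi> \<in> v" for \<psi>
  proof (rule ccontr)
    assume "K a \<psi> \<notin> w"
    then have "Neg (K a \<psi>) \<in> v"
      using world_Neg_K[OF assms(1)] world_subset[OF assms(2)] assms(3) that by blast
    then show False
      using world_ImpL[OF assms(2)] that world_Bot[OF assms(2)] by blast
  qed
  then show ?thesis
    using assms(3) by (auto simp: Kfms_def)
qed

lemma world_T:
  assumes "world w" "K a \<phi> \<in> w"
  shows "\<phi> \<in> w"
proof -
  from world_ruleL[OF assms T]
  have "\<not> prov S [] (unf (insert \<phi> w) \<turnstile> unf (S - w))"
    by (auto simp: insert_unf)
  from unprov_disjoint[OF this] show ?thesis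
    using world_subset[OF assms(1)] closedD(4)[of a \<phi>] assms by auto
qed

text \<open>All \<open>K a\<close> formulae of both sides are retained; taking the two full sides as
  weakening parts absorbs the rest.\<close>

lemma S5_instance:
  "rule_instance R_S5 {# unf (K a ` Kfms a w) \<turnstile> insert (\<phi>, x) (unf (K a ` Kfms a (S - w))) #}
    (unf w \<turnstile> insert (K a \<phi>, x) (unf (S - w)))"
proof -
  have "unf w \<union> K_set a (unf (Kfms a w)) = unf w"
    "K_set a (unf (Kfms a (S - w))) \<union> unf (S - w) = unf (S - w)"
    by (auto simp: K_set_unf Kfms_def)
  then show ?thesis
    using rule_instance.S5[of a "unf (Kfms a w)" \<phi> x "unf (Kfms a (S - w))" "unf w" "unf (S - w)"]
    by (simp only: K_set_unf)
qed

text \<open>The S5 premise fixes the \<open>K a\<close> formulae positively on the left and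
  negatively on the right, so its saturations are accessible from \<open>w\<close>.\<close>

lemma S5_saturated:
  assumes "K a ` Kfms a w \<subseteq> v" "v \<subseteq> S" "v \<inter> K a ` Kfms a (S - w) = {}"
  shows "Kfms a v = Kfms a w"
proof -
  have "K a \<psi> \<in> v \<longleftrightarrow> K a \<psi> \<in> w" for \<psi>
    using assms unfolding Kfms_def by blast
  then show ?thesis
    by (simp add: Kfms_def)
qed

lemma world_KR:
  assumes "world w" "K a \<phi> \<in> S" "K a \<phi> \<notin> w"
  shows "\<exists>v. world v \<and> Kfms a v = Kfms a w \<and> \<phi> \<notin> v"
proof -
  have w: "w \<subseteq> S"
    using world_subset[OF assms(1)] .
  have "insert (K a \<phi>, Unfoc) (unf (S - w)) = unf (S - w)"
    using assms by auto
  then have "rule_instance R_S5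
      {# unf (K a ` Kfms a w) \<turnstile> insert (\<phi>, Unfoc) (unf (K a ` Kfms a (S - w))) #}
      (unf w \<turnstile> unf (S - w))"
    using S5_instance[of a w \<phi> Unfoc] by simp
  from world_rule[OF assms(1) this]
  have unprov: "\<not> prov S [] (unf (K a ` Kfms a w) \<turnstile> unf (insert \<phi> (K a ` Kfms a (S - w))))"
    by (simp add: insert_unf)
  have "K a ` Kfms a w \<subseteq> S" "insert \<phi> (K a ` Kfms a (S - w)) \<subseteq> S"
    using w closedD(4)[OF assms(2)] by (auto simp: Kfms_def)
  from world_extends[OF this unprov] obtain v where
    v: "world v" "K a ` Kfms a w \<subseteq> v" "v \<inter> insert \<phi> (K a ` Kfms a (S - w)) = {}"
    by blast
  have "Kfms a v = Kfms a w"
    using S5_saturated[OF v(2) world_subset[OF v(1)]] v(3) by simp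
  with v show ?thesis
    by auto
qed

section \<open>Common knowledge in worlds, and the construction of loops\<close>

lemma world_CL:
  assumes "world w" "CK \<phi> \<in> w"
  shows "\<phi> \<in> w" "K a (CK \<phi>) \<in> w"
proof -
  have S: "\<phi> \<in> S" "\<And>a. K a (CK \<phi>) \<in> S" "w \<subseteq> S"
    using world_subset[OF assms(1)] closedD(5)[of \<phi>] assms by auto
  have "insert (\<phi>, Unfoc) (range (\<lambda>a. (K a (CK \<phi>), Unfoc)) \<union> unf w) =
      unf (insert \<phi> (range (\<lambda>a. K a (CK \<phi>)) \<union> w))"
    by auto
  with world_ruleL[OF assms CL]
  have "\<not> prov S [] (unf (insert \<phi> (range (\<lambda>a. K a (CK \<phi>)) \<union> w)) \<turnstile> unf (S - w))"
    by auto
  from unprov_disjoint[OF this] show "\<phi> \<in> w" "K a (CK \<phi>) \<in> w"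
    using S by auto
qed

text \<open>These branches leave the loop: either identity applies to the focused formula, or rule u
  drops the focus and leaves the sequent of a set that is not a world.\<close>

lemma prov_focused:
  assumes "CK \<phi> \<in> S" "v \<subseteq> S" "\<not> world v"
  shows "prov S H (unf v \<turnstile> unf (S - v) \<union> {(CK \<phi>, Foc)})"
proof (cases "CK \<phi> \<in> v")
  case True
  with assms show ?thesis
    by (intro prov_id[where \<phi> = "CK \<phi>" and x = Foc]) (auto simp: focus_set_def)
next
  case False
  then have "insert (CK \<phi>, Unfoc) (unf (S - v)) = unf (S - v)"
    using assms(1) by auto
  then have "rule_instance R_u {# unf v \<turnstile> unf (S - v) #}
      (unf v \<turnstile> unf (S - v) \<union> {(CK \<phi>, Foc)})"
    using rule_instance.u[of "unf v" "CK \<phi>" "unf (S - v)"] by simp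
  moreover have "focus_set S {(CK \<phi>, Foc)}"
    using assms(1) by (simp add: focus_set_def)
  note unf_sequent[OF assms(2) _ this, of "S - v"]
  ultimately show ?thesis
    by (rule prov_rule_closed) (use assms in \<open>auto simp: world_def\<close>)
qed

text \<open>\<open>X\<close> is closed under steps to accessible worlds, and \<open>V\<close>
  collects the members already visited, whose focused sequents are loop targets. The induction is on
  the number of unvisited members: an unvisited one is expanded, a visited one closes its
  branch.\<close>

lemma prov_common_knowledge:
  assumes "CK \<phi> \<in> S"
    and X: "finite X" "\<And>v. v \<in> X \<Longrightarrow> v \<subseteq> S \<and> \<phi> \<in> v"
    and step: "\<And>v v' a. v \<in> X \<Longrightarrow> world v' \<Longrightarrow> Kfms a v' = Kfms a v \<Longrightarrow> v' \<in> X"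
    and "w \<in> X" "V \<subseteq> X"
    and "(\<lambda>v. unf v \<turnstile> unf (S - v) \<union> {(CK \<phi>, Foc)}) ` V \<subseteq> loops H"
  shows "prov S H (unf w \<turnstile> unf (S - w) \<union> {(CK \<phi>, Foc)})"
  using assms(5-)
proof (induction "card (X - V)" arbitrary: V w H rule: less_induct)
  case less
  let ?E = "{(CK \<phi>, Foc)}"
  let ?F = "\<lambda>v. unf v \<turnstile> unf (S - v) \<union> ?E"
  have E: "focus_set S ?E" "\<And>a. focus_set S {(K a (CK \<phi>), Foc)}"
    using assms(1) closedD(5) by (auto simp: focus_set_def)
  have w: "w \<subseteq> S" "\<phi> \<in> w" "\<phi> \<in> S"
    using X less.prems by blast+
  have Fw: "is_sequent (?F w)" "formulae (?F w) \<subseteq> S"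
    using unf_sequent[OF _ _ E(1)] w by auto
  show ?case
  proof (cases "w \<in> V")
    case True
    then have "?F w \<in> loops H"
      using less.prems(3) by blast
    then show ?thesis
      by (rule prov_loop[OF Fw])
  next
    case False
    \<comment> \<open>From here on \<open>w\<close> counts as visited: the CR step just made turns
      its sequent into a target.\<close>
    let ?H = "H @ [(?F w, R_CR Foc)]"
    let ?L = "?F ` insert w V"
    have "has_focus (?F w)"
      by (auto simp: has_focus_def)
    then have L: "?L \<subseteq> loops ?H"
      using loops_snoc[of "?F w" H] loops_snoc_CR[of "?F w" H] less.prems(3) by blast
    have card: "card (X - insert w V) < card (X - V)"
      by (rule psubset_card_mono; use False less.prems(1) X(1) in auto)
    \<comment> \<open>A saturated set accessible from \<open>w\<close> is either a world, hence in
      \<open>X\<close> and covered by induction, or already provable.\<close>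
    have sat: "prov S H' (?F v)"
      if "?L \<subseteq> loops H'" "v \<subseteq> S" "Kfms a v = Kfms a w" for H' v a
    proof (cases "world v")
      case True
      then show ?thesis
        using less.hyps[OF card] step[OF less.prems(1) True that(3)] less.prems that(1) by auto
    next
      case False
      then show ?thesis
        by (rule prov_focused[OF assms(1) that(2)])
    qed
    \<comment> \<open>An identity axiom, since all members of \<open>X\<close> contain
      \<open>\<phi>\<close>.\<close>
    have left: "prov S ?H (unf w \<turnstile> insert (\<phi>, Unfoc) (unf (S - w)))"
      using prov_id[of w "insert \<phi> (S - w)" "{}" \<phi> Unfoc ?H] w
      by (auto simp: insert_unf focus_set_def)
    \<comment> \<open>CR moves the focus to \<open>K a (CK \<phi>)\<close>, S5 moves it back to
      \<open>CK \<phi>\<close>, and the cuts keep it, so no target is lost on the way.\<close>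
    have right: "prov S ?H (unf w \<turnstile> insert (K a (CK \<phi>), Foc) (unf (S - w)))" for a
    proof -
      let ?s = "unf w \<turnstile> insert (K a (CK \<phi>), Foc) (unf (S - w))"
      let ?H' = "?H @ [(?s, R_S5)]"
      let ?p = "unf (K a ` Kfms a w) \<turnstile> unf (K a ` Kfms a (S - w)) \<union> ?E"
      have s: "is_sequent ?s" "formulae ?s \<subseteq> S"
        using unf_sequent[OF _ _ E(2), of w "S - w" a] w by auto
      have "has_focus ?s"
        by (auto simp: has_focus_def)
      then have L': "?L \<subseteq> loops ?H'"
        using L loops_snoc by blast
      have "prov S ?H' ?p"
      proof (rule prov_saturate[OF _ _ E(1) L'])
        show "K a ` Kfms a w \<subseteq> S" "K a ` Kfms a (S - w) \<subseteq> S"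
          using w(1) by (auto simp: Kfms_def)
        show "prov S H'' (?F v)"
          if "?L \<subseteq> loops H''" "K a ` Kfms a w \<subseteq> v" "v \<subseteq> S" "v \<inter> K a ` Kfms a (S - w) = {}"
          for H'' v
          by (rule sat[OF that(1,3) S5_saturated[OF that(2-4)]])
      qed simp
      moreover have "rule_instance R_S5 {# ?p #} ?s"
        using S5_instance[of a w "CK \<phi>" Foc] by simp
      ultimately show ?thesis
        by (intro prov_rule[OF s]) auto
    qed
    have "rule_instance (R_CR Foc)
        (add_mset (unf w \<turnstile> insert (\<phi>, Unfoc) (unf (S - w)))
          (image_mset (\<lambda>a. unf w \<turnstile> insert (K a (CK \<phi>), Foc) (unf (S - w))) (mset_set UNIV)))
        (?F w)"
      using rule_instance.CR[of Foc "unf w" \<phi> "unf (S - w)"] by simp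
    then show ?thesis
      by (rule prov_rule[OF Fw]) (use left right in auto)
  qed
qed

text \<open>If \<open>\<phi>\<close> held throughout \<open>X\<close>, the loop construction,
  started with nothing visited, would prove the focused sequent of \<open>w\<close>; rule f then
  proves the unfocused one, against \<open>w\<close> being a world.\<close>

lemma world_CR:
  assumes "world w" "CK \<phi> \<in> S" "CK \<phi> \<notin> w"
    and X: "w \<in> X" "X \<subseteq> Collect world"
    and step: "\<And>v v' a. v \<in> X \<Longrightarrow> world v' \<Longrightarrow> Kfms a v' = Kfms a v \<Longrightarrow> v' \<in> X"
  shows "\<exists>v \<in> X. \<phi> \<notin> v"
proof (rule ccontr)
  assume *: "\<not> ?thesis"
  have "X \<subseteq> Pow S"
    using X(2) world_subset by blast
  then have "finite X"
    using finite_S finite_subset by blast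
  have "prov S [] (unf w \<turnstile> unf (S - w) \<union> {(CK \<phi>, Foc)})"
  proof (rule prov_common_knowledge[where V = "{}", OF assms(2) \<open>finite X\<close> _ _ X(1)])
    show "v \<subseteq> S \<and> \<phi> \<in> v" if "v \<in> X" for v
      using * \<open>X \<subseteq> Pow S\<close> that by blast
  qed (simp_all add: step)
  moreover have "insert (CK \<phi>, Unfoc) (unf (S - w)) = unf (S - w)"
    using assms(2,3) by auto
  then have "rule_instance R_f {# unf w \<turnstile> unf (S - w) \<union> {(CK \<phi>, Foc)} #}
      (unf w \<turnstile> unf (S - w))"
    using rule_instance.f[of "unf w" "CK \<phi>" "unf (S - w)"] by simp
  ultimately show False
    using world_rule[OF assms(1), of R_f] by force
qed

section \<open>The canonical model and the truth lemma\<close>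

context
  fixes W :: "'w set" and g :: "'w \<Rightarrow> ('a, 'p) fm set"
  assumes bij: "bij_betw g W (Collect world)"
begin

text \<open>Validity is assumed over frames on the type \<open>'w\<close>, so the worlds are
  represented by elements of \<open>W\<close> through the bijection \<open>g\<close>.\<close>

definition can_frame :: "('w, 'a) frame" where
  "can_frame = \<lparr>worlds = W, le = {(x, y). x \<in> W \<and> y \<in> W \<and> g x \<subseteq> g y},
     acc = (\<lambda>a. {(x, y). x \<in> W \<and> y \<in> W \<and> Kfms a (g x) = Kfms a (g y)})\<rparr>"

definition can_val :: "'w \<Rightarrow> 'p set" where
  "can_val x = {p. Atom p \<in> g x}"

lemma world_g: "x \<in> W \<Longrightarrow> world (g x)"
  using bij by (auto dest: bij_betwE)

lemma g_surj: "world v \<Longrightarrow> \<exists>x \<in> W. v = g x"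
  using bij by (auto simp: bij_betw_def)

text \<open>Antisymmetry comes from injectivity of \<open>g\<close>, equivalence from accessibility
  being an equality, and confluence from \<open>world_mono_Kfms\<close>.\<close>

lemma can_frame_S5:
  assumes "W \<noteq> {}"
  shows "can_frame \<in> S5_frames"
proof -
  have "partial_order_on (worlds can_frame) (le can_frame)"
    using bij
    by (auto simp: can_frame_def partial_order_on_def preorder_on_def refl_on_def trans_def
        antisym_def bij_betw_def inj_on_def)
  moreover have "equiv (worlds can_frame) (acc can_frame a)" for a
    by (auto simp: can_frame_def intro!: equivI refl_onI symI transI)
  moreover have "(w, u) \<in> acc can_frame a"
    if "(w, v) \<in> le can_frame" "(v, u) \<in> acc can_frame a" for a w v u
    using that world_mono_Kfms[of "g w" "g v" a] world_g by (auto simp: can_frame_def)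
  ultimately show ?thesis
    using assms by (auto simp: S5_frames_def can_frame_def)
qed

lemma can_val_monotone: "monotone_valuation can_frame can_val"
  by (auto simp: monotone_valuation_def can_frame_def can_val_def)

lemma truth:
  assumes "x \<in> W" "\<phi> \<in> S"
  shows "sat can_frame can_val x \<phi> \<longleftrightarrow> \<phi> \<in> g x"
  using assms
proof (induction \<phi> arbitrary: x)
  case Bot
  then show ?case using world_Bot world_g by auto
next
  case (Atom p)
  then show ?case by (simp add: can_val_def)
next
  case (And \<phi> \<psi>)
  then show ?case using closedD(1)[OF And.prems(2)] world_And world_g by auto
next
  case (Or \<phi> \<psi>)
  then show ?case using closedD(2)[OF Or.prems(2)] world_Or world_g by auto
next
  case (Imp \<phi> \<psi>)
  have S: "\<phi> \<in> S" "\<psi> \<in> S"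
    using closedD(3)[OF Imp.prems(2)] by auto
  have "sat can_frame can_val x (Imp \<phi> \<psi>) \<longleftrightarrow>
      (\<forall>y \<in> W. g x \<subseteq> g y \<longrightarrow> \<phi> \<in> g y \<longrightarrow> \<psi> \<in> g y)"
    using Imp S by (auto simp: can_frame_def)
  also have "\<dots> \<longleftrightarrow> Imp \<phi> \<psi> \<in> g x"
    using world_ImpR[OF world_g[OF Imp.prems(1)] Imp.prems(2)] world_ImpL[OF world_g] g_surj
    by blast
  finally show ?case .
next
  case (K a \<phi>)
  have S: "\<phi> \<in> S"
    using closedD(4)[OF K.prems(2)] by auto
  have "sat can_frame can_val x (K a \<phi>) \<longleftrightarrow>
      (\<forall>y \<in> W. Kfms a (g x) = Kfms a (g y) \<longrightarrow> \<phi> \<in> g y)"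
    using K S by (auto simp: can_frame_def)
  also have "\<dots> \<longleftrightarrow> K a \<phi> \<in> g x"
  proof
    assume *: "\<forall>y \<in> W. Kfms a (g x) = Kfms a (g y) \<longrightarrow> \<phi> \<in> g y"
    show "K a \<phi> \<in> g x"
      using world_KR[OF world_g[OF K.prems(1)] K.prems(2)] * g_surj by metis
  next
    assume "K a \<phi> \<in> g x"
    then have "K a \<phi> \<in> g y" if "Kfms a (g x) = Kfms a (g y)" for y
      using that by (auto simp: Kfms_def)
    then show "\<forall>y \<in> W. Kfms a (g x) = Kfms a (g y) \<longrightarrow> \<phi> \<in> g y"
      using world_T world_g by blast
  qed
  finally show ?case .
next
  case (CK \<phi>)
  let ?R = "(\<Union>a. acc can_frame a)\<^sup>*"
  have S: "\<phi> \<in> S"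
    using closedD(5)[OF CK.prems(2)] by auto
  have reach_W: "y \<in> W" if "(x, y) \<in> ?R" for y
    using that CK.prems(1) by (induction rule: rtrancl_induct) (auto simp: can_frame_def)
  have "sat can_frame can_val x (CK \<phi>) \<longleftrightarrow> (\<forall>y. (x, y) \<in> ?R \<longrightarrow> \<phi> \<in> g y)"
    using CK.IH S reach_W by auto
  also have "\<dots> \<longleftrightarrow> CK \<phi> \<in> g x"
  proof
    assume *: "\<forall>y. (x, y) \<in> ?R \<longrightarrow> \<phi> \<in> g y"
    \<comment> \<open>The worlds reachable from \<open>x\<close>, closed under accessibility, so a
      missing \<open>CK \<phi>\<close> produces a reachable world without
      \<open>\<phi>\<close>.\<close>
    let ?X = "g ` {y. (x, y) \<in> ?R}"
    have "g x \<in> ?X"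
      by blast
    moreover have "?X \<subseteq> Collect world"
      using reach_W world_g by blast
    moreover have "v' \<in> ?X" if v: "v \<in> ?X" "world v'" "Kfms a v' = Kfms a v" for v v' a
    proof -
      from v obtain y z where y: "v = g y" "(x, y) \<in> ?R" and z: "z \<in> W" "v' = g z"
        using g_surj[of v'] by blast
      have "(y, z) \<in> acc can_frame a"
        using v(3) y(1) z reach_W[OF y(2)] by (simp add: can_frame_def)
      then have "(y, z) \<in> (\<Union>a. acc can_frame a)"
        by blast
      with y(2) have "(x, z) \<in> ?R"
        by (rule rtrancl_into_rtrancl)
      with z(2) show ?thesis
        by blast
    qed
    ultimately have "\<exists>v \<in> ?X. \<phi> \<notin> v" if "CK \<phi> \<notin> g x"
      by (rule world_CR[OF world_g[OF CK.prems(1)] CK.prems(2) that])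
    with * show "CK \<phi> \<in> g x"
      by blast
  next
    assume *: "CK \<phi> \<in> g x"
    \<comment> \<open>\<open>CK \<phi>\<close> travels along paths: CL yields
      \<open>K a (CK \<phi>)\<close>, accessible worlds share it, and T strips the
      \<open>K a\<close>.\<close>
    have "CK \<phi> \<in> g y" if "(x, y) \<in> ?R" for y
      using that
    proof (induction rule: rtrancl_induct)
      case (step y z)
      then obtain a where a: "z \<in> W" "y \<in> W" "Kfms a (g y) = Kfms a (g z)"
        by (auto simp: can_frame_def)
      have "K a (CK \<phi>) \<in> g z"
        using world_CL(2)[OF world_g[OF a(2)] step.IH, of a] a(3) by (auto simp: Kfms_def)
      then show ?case
        using world_T world_g a(1) by blast
    qed (use * in simp)
    then show "\<forall>y. (x, y) \<in> ?R \<longrightarrow> \<phi> \<in> g y"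
      using world_CL(1) world_g reach_W by blast
  qed
  finally show ?case .
qed

end

end


section \<open>Completeness\<close>

lemma set_enum_of: "finite A \<Longrightarrow> set (enum_of A) = A"
  unfolding enum_of_def by (rule someI2_ex[OF finite_distinct_list]) auto

lemma sat_big_And:
  assumes "finite A"
  shows "sat F V w (big_And A) \<longleftrightarrow> (\<forall>\<phi> \<in> A. sat F V w \<phi>)"
proof -
  have "sat F V w (foldr And xs (Neg Bot)) \<longleftrightarrow> (\<forall>\<phi> \<in> set xs. sat F V w \<phi>)" for xs
    by (induction xs) auto
  then show ?thesis
    using set_enum_of[OF assms] by (simp add: big_And_def)
qed

lemma sat_big_Or:
  assumes "finite A"
  shows "sat F V w (big_Or A) \<longleftrightarrow> (\<exists>\<phi> \<in> A. sat F V w \<phi>)"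
proof -
  have "sat F V w (foldr Or xs Bot) \<longleftrightarrow> (\<exists>\<phi> \<in> set xs. sat F V w \<phi>)" for xs
    by (induction xs) auto
  then show ?thesis
    using set_enum_of[OF assms] by (simp add: big_Or_def)
qed

text \<open>Worlds refute unfocused sequents; a focus at the root is removed by one instance of rule
  u. Since that instance enters the history, the hypothesis covers every \<open>H\<close>.\<close>

lemma prov_unfocus:
  assumes "is_sequent \<sigma>" "formulae \<sigma> \<subseteq> S"
    and "\<And>H. prov S H (unf (unannot (ant \<sigma>)) \<turnstile> unf (unannot (suc \<sigma>)))"
  shows "prov S [] \<sigma>"
proof -
  obtain \<Gamma> \<Delta> where \<sigma>: "\<sigma> = (\<Gamma> \<turnstile> \<Delta>)"
    by (cases \<sigma>)
  have \<Gamma>: "\<Gamma> = unf (unannot \<Gamma>)"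
    using assms(1) by (force simp: \<sigma> is_sequent_def unannot_def)
  show ?thesis
  proof (cases "\<exists>\<phi>. (\<phi>, Foc) \<in> \<Delta>")
    case True
    then obtain \<phi> where \<phi>: "(\<phi>, Foc) \<in> \<Delta>" ..
    let ?\<Delta> = "\<Delta> - {(\<phi>, Foc)}"
    \<comment> \<open>A sequent has at most one focused formula, and it has been taken out.\<close>
    have unfoc: "x = Unfoc" if "(\<psi>, x) \<in> ?\<Delta>" for \<psi> x
      using assms(1) that \<phi> by (cases x) (auto simp: \<sigma> is_sequent_def)
    have "insert (\<phi>, Unfoc) ?\<Delta> = unf (unannot \<Delta>)"
    proof (rule set_eqI, clarify)
      fix \<psi> x
      show "(\<psi>, x) \<in> insert (\<phi>, Unfoc) ?\<Delta> \<longleftrightarrow> (\<psi>, x) \<in> unf (unannot \<Delta>)"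
      proof
        assume "(\<psi>, x) \<in> insert (\<phi>, Unfoc) ?\<Delta>"
        then show "(\<psi>, x) \<in> unf (unannot \<Delta>)"
          using unfoc \<phi> by (force simp: unannot_def)
      next
        assume "(\<psi>, x) \<in> unf (unannot \<Delta>)"
        then obtain y where "(\<psi>, y) \<in> \<Delta>" "x = Unfoc"
          by (auto simp: unannot_def)
        then show "(\<psi>, x) \<in> insert (\<phi>, Unfoc) ?\<Delta>"
          using unfoc[of \<psi> y] by (cases "(\<psi>, y) = (\<phi>, Foc)") auto
      qed
    qed
    moreover have "insert (\<phi>, Foc) ?\<Delta> = \<Delta>"
      using \<phi> by auto
    ultimately have "rule_instance R_u {# unf (unannot \<Gamma>) \<turnstile> unf (unannot \<Delta>) #} \<sigma>"
      using rule_instance.u[of \<Gamma> \<phi> ?\<Delta>] \<Gamma> by (simp add: \<sigma>)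
    then show ?thesis
      by (rule prov_rule[OF assms(1,2)]) (use assms(3) in \<open>auto simp: \<sigma>\<close>)
  next
    case False
    have "(\<psi>, x) \<in> \<Delta> \<longleftrightarrow> (\<psi>, x) \<in> unf (unannot \<Delta>)" for \<psi> x
    proof
      assume "(\<psi>, x) \<in> \<Delta>"
      then show "(\<psi>, x) \<in> unf (unannot \<Delta>)"
        using False by (cases x) (force simp: unannot_def)+
    next
      assume "(\<psi>, x) \<in> unf (unannot \<Delta>)"
      then obtain y where "(\<psi>, y) \<in> \<Delta>" "x = Unfoc"
        by (auto simp: unannot_def)
      then show "(\<psi>, x) \<in> \<Delta>"
        using False by (cases y) auto
    qed
    then have "\<Delta> = unf (unannot \<Delta>)"
      by auto
    then show ?thesis
      using assms(3)[of "[]"] \<Gamma> by (simp add: \<sigma>)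
  qed
qed

theorem mainTheorem17:
  fixes \<sigma> :: "('a::finite, 'p) sequent"
  assumes "is_sequent \<sigma>"
    and "infinite (UNIV :: 'w set)"
    and "sequent_valid_over (S5_frames :: ('w, 'a) frame set) \<sigma>"
  shows "\<exists>t. cyclic_proof t \<sigma> \<and> (\<forall>p \<in> nodes t. formulae (label t p) \<subseteq> Cl_neg \<sigma>)"
proof -
  let ?S = "Cl_neg \<sigma>"
  let ?A = "unannot (ant \<sigma>)" and ?B = "unannot (suc \<sigma>)"
  interpret finite_closure ?S
    using finite_Cl_neg[OF assms(1)] negation_closed_Cl_neg by unfold_locales
  have AB: "?A \<subseteq> ?S" "?B \<subseteq> ?S" "formulae \<sigma> \<subseteq> ?S"
    using formulae_subset_Cl_neg[of \<sigma>] by (auto simp: formulae_def)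
  have fin: "finite ?A" "finite ?B"
    using assms(1) by (auto simp: is_sequent_def unannot_def)
  have "prov ?S H (unf ?A \<turnstile> unf ?B)" for H
  proof (rule ccontr)
    assume "\<not> ?thesis"
    then obtain w where w: "world w" "?A \<subseteq> w" "w \<inter> ?B = {}"
      using world_extends[OF AB(1,2)] by blast
    have "finite (Collect world)"
      by (rule finite_subset[of _ "Pow ?S"]) (use world_subset finite_S in auto)
    \<comment> \<open>Infinity of \<open>'w\<close> makes room for a copy of the finite set of
      worlds.\<close>
    moreover obtain W :: "'w set" where "finite W" "card W = card (Collect world)"
      using infinite_arbitrarily_large[OF assms(2)] by blast
    ultimately obtain g where g: "bij_betw g W (Collect world)"
      using finite_same_card_bij by metis
    obtain x where x: "x \<in> W" "w = g x"
      using g_surj[OF g w(1)] by blast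
    then have "can_frame W g \<in> S5_frames"
      using can_frame_S5[OF g] by blast
    then have "sat (can_frame W g) (can_val g) x (Imp (big_And ?A) (big_Or ?B))"
      using assms(3) can_val_monotone[OF g] x
      unfolding sequent_valid_over_def valid_over_def by (simp add: can_frame_def[OF g])
    \<comment> \<open>Reflexivity lets the valid implication be evaluated at \<open>x\<close>
      itself.\<close>
    moreover have "(x, x) \<in> le (can_frame W g)"
      using x by (simp add: can_frame_def[OF g])
    moreover have "sat (can_frame W g) (can_val g) x (big_And ?A)"
      unfolding sat_big_And[OF fin(1)] using truth[OF g x(1)] AB(1) w(2) x(2) by auto
    ultimately have "sat (can_frame W g) (can_val g) x (big_Or ?B)"
      by simp
    then obtain \<psi> where "\<psi> \<in> ?B" "sat (can_frame W g) (can_val g) x \<psi>"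
      unfolding sat_big_Or[OF fin(2)] by blast
    then show False
      using truth[OF g x(1), of \<psi>] AB(2) w(3) x(2) by auto
  qed
  then have "prov ?S [] \<sigma>"
    using prov_unfocus[OF assms(1) AB(3)] by blast
  then show ?thesis
    by (rule prov_cyclic_proof)
qed

end
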